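(* There exists $t_0>\log 2$ such that $\Psi(t)>0$ for $0<t<t_0$.
   Context: $\Lambda$ is the von Mangoldt function, $G$ is Catalan's constant, $C=\pi^2+8G$, $\Phi(z,s,a)=\sum_{n\ge0}(n+a)^{-s}z^n$ is the Hurwitz–Lerch zeta function. For $t\ge0$, \[\Psi(t):=4(e^{t/2}+e^{-t/2}-2)-\sum_{n\le e^t}\frac{\Lambda(n)}{\sqrt n}(t-\log n)+\frac t2\Big[\frac{\Gamma'}{\Gamma}\Big(\frac14\Big)-\log\pi\Big]+\frac14\Big(C-e^{-t/2}\Phi(e^{-2t},2,1/4)\Big).\] *)

theory Defs
  imports "HOL-Analysis.Analysis" "HOL-Number_Theory.Prime_Powers"
begin

definition catalan_const :: real where
  "catalan_const = (\<Sum>n. (-1) ^ n / real (2 * n + 1) ^ 2)"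

text \<open>
  The Hurwitz--Lerch zeta function, given by its series; it carries its mathematical meaning
  only where the series converges (for real arguments with \<open>a > 0\<close>: if \<open>\<bar>z\<bar> < 1\<close>, or if
  \<open>z = 1\<close> and \<open>s > 1\<close>). The arguments may be real or complex.
\<close>

definition Lerch_Phi :: "'a \<Rightarrow> 'a \<Rightarrow> 'a \<Rightarrow> 'a :: {real_normed_field, banach, ln}" where
  "Lerch_Phi z s a = (\<Sum>n. (of_nat n + a) powr (-s) * z ^ n)"

definition C_const :: real where
  "C_const = pi ^ 2 + 8 * catalan_const"

text \<open>The intended domain is \<open>t \<ge> 0\<close>. The index set below is \<open>{n \<ge> 1. n \<le> e\<^sup>t}\<close>.\<close>

definition Psi :: "real \<Rightarrow> real" where
  "Psi t =
     4 * (exp (t / 2) + exp (- t / 2) - 2)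
     - (\<Sum>n = 1..nat \<lfloor>exp t\<rfloor>. mangoldt n / sqrt (real n) * (t - ln (real n)))
     + t / 2 * (deriv Gamma (1 / 4) / Gamma (1 / 4) - ln pi)
     + 1 / 4 * (C_const - exp (- t / 2) * Lerch_Phi (exp (- 2 * t)) 2 (1 / 4))"

end

theory Submission
  imports Defs "HOL-Real_Asymp.Real_Asymp"
begin

text \<open>
  With \<open>y = e\<^sup>-\<^sup>t\<^sup>/\<^sup>2\<close>, the identity \<open>C = \<Sum>n. 16 / (4 n + 1)\<^sup>2\<close> turns \<open>\<Psi>\<close>, for \<open>t < ln 2\<close>, into
  \<open>4 (1 - y)\<^sup>2 / y - \<bar>L\<bar> (- ln y) + 4 (\<Sum>n. (1 - y\<^sup>4\<^sup>n\<^sup>+\<^sup>1) / (4 n + 1)\<^sup>2)\<close>, where \<open>L = \<Gamma>'/\<Gamma> (1/4) - ln \<pi> \<ge> - 27/5\<close>.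
  All terms of the series are positive. Keeping three of them, bounding the remaining ones below by a
  telescoping series, and bounding \<open>- ln y\<close> above by a rational function makes \<open>1 - y\<close> a common
  factor; a polynomial inequality on \<open>[7/10, 1]\<close> is left. It holds with a margin that also absorbs
  the \<open>n = 2\<close> term of the von Mangoldt sum slightly beyond \<open>ln 2\<close>.
\<close>

section \<open>Series for \<open>C_const\<close> and for the Lerch term\<close>

text \<open>Grouping the Basel series in pairs isolates the even denominators, which form a quarter
  of the same series and are subtracted.\<close>

lemma sums_inverse_odd_squares: "(\<lambda>n. 1 / real (2 * n + 1) ^ 2) sums (pi\<^sup>2 / 8)"
proof -
  have all: "(\<lambda>n. 1 / (real n + 1) ^ 2) sums (pi\<^sup>2 / 6)"
    using inverse_squares_sums by (simp add: add_ac)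
  have "(\<lambda>n. \<Sum>i=n*2..<n*2+2. 1 / (real i + 1) ^ 2) sums (pi\<^sup>2 / 6)"
    by (rule sums_group[OF all]) simp
  moreover have "(\<Sum>i=n*2..<n*2+2. 1 / (real i + 1) ^ 2)
      = 1 / real (2 * n + 1) ^ 2 + 1 / 4 * (1 / (real n + 1) ^ 2)" for n
  proof -
    have "(2 * real n + 2) ^ 2 = 4 * (real n + 1) ^ 2"
      by (simp add: power2_eq_square algebra_simps)
    then show ?thesis
      by (simp add: numeral_2_eq_2 add.commute mult.commute)
  qed
  ultimately have "(\<lambda>n. 1 / real (2 * n + 1) ^ 2 + 1 / 4 * (1 / (real n + 1) ^ 2)) sums (pi\<^sup>2 / 6)"
    by simp
  from sums_diff[OF this sums_mult[OF all, of "1 / 4"]]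
  show ?thesis
    by simp
qed

lemma sums_catalan_const: "(\<lambda>n. (-1) ^ n / real (2 * n + 1) ^ 2) sums catalan_const"
proof -
  have "summable (\<lambda>n. (-1) ^ n / real (2 * n + 1) ^ 2)"
    by (rule summable_comparison_test[OF _ sums_summable[OF sums_inverse_odd_squares]]) auto
  then show ?thesis
    unfolding catalan_const_def by (rule summable_sums)
qed

text \<open>Since \<open>C_const\<close> is 8 times \<open>pi^2 / 8 + catalan_const\<close>, the two
  series over odd denominators are added: terms of even index double, those of odd index
  cancel.\<close>

lemma sums_C_const: "(\<lambda>n. 16 / real (4 * n + 1) ^ 2) sums C_const"
proof -
  let ?f = "\<lambda>n. 1 / real (2 * n + 1) ^ 2 + (-1) ^ n / real (2 * n + 1) ^ 2"
  have "?f sums (pi\<^sup>2 / 8 + catalan_const)"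
    by (intro sums_add sums_inverse_odd_squares sums_catalan_const)
  then have "(\<lambda>n. sum ?f {n*2..<n*2+2}) sums (pi\<^sup>2 / 8 + catalan_const)"
    by (rule sums_group) simp
  moreover have "sum ?f {n*2..<n*2+2} = 2 / real (4 * n + 1) ^ 2" for n
  proof -
    have "{n*2..<n*2+2} = {2 * n, 2 * n + 1}"
      by auto
    then show ?thesis
      by simp
  qed
  ultimately have "(\<lambda>n. 2 / real (4 * n + 1) ^ 2) sums (pi\<^sup>2 / 8 + catalan_const)"
    by simp
  from sums_mult[OF this, of 8] show ?thesis
    by (simp add: C_const_def distrib_left)
qed

lemma Lerch_Phi_quarter:
  "16 * exp (- t / 2) ^ (4 * n + 1) / real (4 * n + 1) ^ 2
    = exp (- t / 2) * ((real n + 1 / 4) powr (-2) * exp (- 2 * t) ^ n)"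
proof -
  have "exp (- 2 * t) = exp (- t / 2) ^ 4"
    by (simp flip: exp_of_nat_mult)
  moreover have "(real n + 1 / 4) powr (-2) = 16 / real (4 * n + 1) ^ 2"
  proof -
    have "real n + 1 / 4 = real (4 * n + 1) / 4"
      by simp
    moreover have "(real (4 * n + 1) / 4) powr (-2) = 1 / (real (4 * n + 1) / 4) ^ 2"
      by (rule powr_neg_numeral) simp
    ultimately show ?thesis
      by (simp only: power_divide) simp
  qed
  ultimately show ?thesis
    by (simp add: power_mult)
qed

lemma sums_C_const_minus_Lerch_Phi:
  assumes "0 \<le> t"
  shows "(\<lambda>n. 16 * (1 - exp (- t / 2) ^ (4 * n + 1)) / real (4 * n + 1) ^ 2)
    sums (C_const - exp (- t / 2) * Lerch_Phi (exp (- 2 * t)) 2 (1 / 4))"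
proof -
  let ?g = "\<lambda>n. (real n + 1 / 4) powr (-2) * exp (- 2 * t) ^ n"
  let ?y = "exp (- t / 2)"
  \<comment> \<open>\<open>Lerch_Phi\<close> is a bare infinite sum, so summability must come first.
    Domination by the series for \<open>C_const\<close> also covers \<open>t = 0\<close>, where
    there is no geometric decay.\<close>
  have "summable (\<lambda>n. 16 * ?y ^ (4 * n + 1) / real (4 * n + 1) ^ 2)"
  proof (rule summable_comparison_test[OF _ sums_summable[OF sums_C_const]], intro exI allI impI)
    fix n
    have "?y ^ (4 * n + 1) \<le> 1"
      using assms by (intro power_le_one) auto
    then show "norm (16 * ?y ^ (4 * n + 1) / real (4 * n + 1) ^ 2) \<le> 16 / real (4 * n + 1) ^ 2"
      by (auto simp: abs_mult intro!: divide_right_mono)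
  qed
  then have "summable (\<lambda>n. ?y * ?g n)"
    by (simp only: Lerch_Phi_quarter)
  then have "summable ?g"
    by (simp add: summable_cmult_iff)
  then have "(\<lambda>n. ?y * ?g n) sums (?y * Lerch_Phi (exp (- 2 * t)) 2 (1 / 4))"
    unfolding Lerch_Phi_def by (intro sums_mult summable_sums)
  then have "(\<lambda>n. 16 * ?y ^ (4 * n + 1) / real (4 * n + 1) ^ 2)
      sums (?y * Lerch_Phi (exp (- 2 * t)) 2 (1 / 4))"
    by (simp only: Lerch_Phi_quarter)
  from sums_diff[OF sums_C_const this] show ?thesis
    by (simp add: diff_divide_distrib right_diff_distrib)
qed

text \<open>From the fourth term on, the power of \<open>y\<close> is at most \<open>y ^ 13\<close>,
  and 16/(4n+13)^2 is at least 4/(4n+13) - 4/(4n+17), which telescopes to 4/13.\<close>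

lemma sum_power_quarter_lower:
  fixes y S :: real
  assumes y: "0 \<le> y" "y \<le> 1"
    and S: "(\<lambda>n. 16 * (1 - y ^ (4 * n + 1)) / real (4 * n + 1) ^ 2) sums S"
  shows "16 * (1 - y) + 16 / 25 * (1 - y ^ 5) + 16 / 81 * (1 - y ^ 9) + 4 / 13 * (1 - y ^ 13) \<le> S"
proof -
  let ?f = "\<lambda>n. 16 * (1 - y ^ (4 * n + 1)) / real (4 * n + 1) ^ 2"
  let ?u = "\<lambda>n. - (4 * (1 - y ^ 13)) * (1 / real (4 * n + 13))"
  have "(\<lambda>n. 1 / real (4 * n + 13)) \<longlonglongrightarrow> 0"
    by real_asymp
  then have "?u \<longlonglongrightarrow> 0"
    by (rule tendsto_mult_right_zero)
  then have "(\<lambda>n. ?u (Suc n) - ?u n) sums (0 - ?u 0)"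
    by (rule telescope_sums)
  also have "0 - ?u 0 = 4 / 13 * (1 - y ^ 13)"
    by (simp add: field_simps)
  finally have tel: "(\<lambda>n. ?u (Suc n) - ?u n) sums (4 / 13 * (1 - y ^ 13))" .
  have tail: "(\<lambda>n. ?f (n + 3)) sums (S - sum ?f {..<3})"
    using S by (rule sums_split_initial_segment)
  have "4 / 13 * (1 - y ^ 13) \<le> S - sum ?f {..<3}"
  proof (rule sums_le[OF _ tel tail])
    fix n
    have "y ^ (4 * (n + 3) + 1) \<le> y ^ 13"
      using y by (intro power_decreasing) auto
    moreover have "y ^ 13 \<le> 1"
      using y by (intro power_le_one) auto
    moreover have "?u (Suc n) - ?u n = 16 * (1 - y ^ 13) / (real (4 * n + 13) * real (4 * n + 17))"
      by (simp add: field_simps)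
    moreover have "real (4 * n + 13) ^ 2 \<le> real (4 * n + 13) * real (4 * n + 17)"
      unfolding power2_eq_square by (intro mult_left_mono) auto
    ultimately have "?u (Suc n) - ?u n \<le> 16 * (1 - y ^ (4 * (n + 3) + 1)) / real (4 * n + 13) ^ 2"
      by (simp only:) (intro frac_le, auto)
    then show "?u (Suc n) - ?u n \<le> ?f (n + 3)"
      by (simp add: algebra_simps)
  qed
  moreover have "sum ?f {..<3} = 16 * (1 - y) + 16 / 25 * (1 - y ^ 5) + 16 / 81 * (1 - y ^ 9)"
    by (simp add: eval_nat_numeral)
  ultimately show ?thesis
    by linarith
qed

section \<open>The coefficient of the linear term\<close>

text \<open>The first two terms of the series give -3 - 3/10. In the tail, the factors
  \<open>n + 3\<close> and \<open>n + 9/4\<close> are replaced by \<open>n + 17/8\<close> and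
  \<open>n + 25/8\<close>: same sum, smaller product, and difference 1, so the new series
  telescopes.\<close>

lemma Digamma_quarter_ge: "Digamma (1 / 4 :: real) \<ge> - euler_mascheroni - 33 / 10 - 6 / 17"
proof -
  let ?f = "\<lambda>k. inverse (of_nat (Suc k)) - inverse (1 / 4 + of_nat k) :: real"
  let ?u = "\<lambda>n. 3 / 4 * (1 / (real n + 17 / 8))"
  have "?f sums (Digamma (1 / 4) + euler_mascheroni)"
    using summable_Digamma[of "1 / 4 :: real"] by (simp add: Digamma_def summable_sums)
  then have tail: "(\<lambda>k. ?f (k + 2)) sums (Digamma (1 / 4) + euler_mascheroni - sum ?f {..<2})"
    by (rule sums_split_initial_segment)
  have "?u \<longlonglongrightarrow> 0"
    by real_asymp
  from telescope_sums[OF this] have tel: "(\<lambda>n. ?u (Suc n) - ?u n) sums (- (6 / 17))"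
    by simp
  have "- (6 / 17) \<le> Digamma (1 / 4) + euler_mascheroni - sum ?f {..<2}"
  proof (rule sums_le[OF _ tel tail])
    fix n
    have "?f (n + 2) = - (3 / 4) / ((real n + 3) * (real n + 9 / 4))"
      by (simp add: field_simps)
    moreover have "?u (Suc n) - ?u n = - (3 / 4) / ((real n + 17 / 8) * (real n + 25 / 8))"
      by (simp add: field_simps)
    moreover have "(real n + 17 / 8) * (real n + 25 / 8) \<le> (real n + 3) * (real n + 9 / 4)"
      by (simp add: field_simps)
    then have "(3 / 4) / ((real n + 3) * (real n + 9 / 4))
        \<le> (3 / 4) / ((real n + 17 / 8) * (real n + 25 / 8))"
      by (intro divide_left_mono) auto
    ultimately show "?u (Suc n) - ?u n \<le> ?f (n + 2)"
      by simp
  qed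
  then show ?thesis
    by (simp add: eval_nat_numeral)
qed

lemma linear_coefficient_ge: "- (27 / 5) \<le> deriv Gamma (1 / 4 :: real) / Gamma (1 / 4) - ln pi"
proof -
  have "(1 / 4 :: real) \<notin> \<int>\<^sub>\<le>\<^sub>0"
    by (auto elim!: nonpos_Ints_cases')
  then have "deriv Gamma (1 / 4 :: real) = Gamma (1 / 4) * Digamma (1 / 4)"
    using has_field_derivative_Gamma by (blast intro: DERIV_imp_deriv)
  moreover have "Gamma (1 / 4 :: real) > 0"
    by (rule Gamma_real_pos) simp
  ultimately have G: "deriv Gamma (1 / 4 :: real) / Gamma (1 / 4) = Digamma (1 / 4)"
    by (simp add: less_imp_neq[symmetric])
  have e: "27182 / 10000 \<le> exp (1 :: real)"
    using e_approx_32 by (simp add: abs_if split: if_splits)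
  \<comment> \<open>The tangent to the logarithm at e is sharp enough, as pi is close to e.\<close>
  have "ln pi = 1 + ln (pi / exp 1)"
    by (simp add: ln_div)
  also have "\<dots> \<le> pi / exp 1"
    using ln_le_minus_one[of "pi / exp 1"] by simp
  also have "\<dots> \<le> (31416 / 10000) / (27182 / 10000)"
    using pi_approx e by (intro frac_le) auto
  finally have "ln pi \<le> (31416 / 10000) / (27182 / 10000)" .
  with G Digamma_quarter_ge euler_mascheroni_less_13_over_22 show ?thesis
    by simp
qed

section \<open>Rational and polynomial estimates\<close>

text \<open>First term of the artanh expansion of \<open>ln (1 / y)\<close>, with the remainder
  bounded by a geometric series.\<close>

lemma minus_ln_le:
  fixes y :: real
  assumes "0 < y" "y < 1"
  shows "- ln y \<le> (1 - y) * (1 + 10 * y + y\<^sup>2) / (6 * y * (1 + y))"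
proof -
  define z where "z = (1 / y - 1) / (1 / y + 1)"
  have z: "z = (1 - y) / (1 + y)"
  proof -
    have "1 / y - 1 = (1 - y) / y" "1 / y + 1 = (1 + y) / y"
      using assms by (simp_all add: field_simps)
    then show ?thesis
      unfolding z_def using assms by simp
  qed
  have "ln (1 / y) \<le> 2 * z + 2 * (z ^ 3 / (1 - z\<^sup>2) / 3)"
    using ln_approx_bounds[of "1 / y" 1] assms unfolding z_def by (simp add: eval_nat_numeral)
  moreover have "1 - z\<^sup>2 = 4 * y / (1 + y)\<^sup>2"
  proof -
    have "1 - z\<^sup>2 = ((1 + y)\<^sup>2 - (1 - y)\<^sup>2) / (1 + y)\<^sup>2"
      using assms unfolding z power_divide by (simp add: diff_divide_distrib)
    also have "(1 + y)\<^sup>2 - (1 - y)\<^sup>2 = 4 * y"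
      by (simp add: power2_eq_square algebra_simps)
    finally show ?thesis .
  qed
  then have "z ^ 3 / (1 - z\<^sup>2) = (1 - y) ^ 3 / (4 * y * (1 + y))"
    using assms unfolding z by (simp add: power_divide power2_eq_square power3_eq_cube)
  moreover have "2 * z + 2 * ((1 - y) ^ 3 / (4 * y * (1 + y)) / 3)
      = (1 - y) * (1 + 10 * y + y\<^sup>2) / (6 * y * (1 + y))"
    using assms unfolding z
    by (simp add: divide_simps) (simp add: algebra_simps power2_eq_square power3_eq_cube)
  ultimately show ?thesis
    using assms by (simp add: ln_div)
qed

text \<open>Bernoulli's inequality for \<open>y / c\<close>, scaled by \<open>c ^ k\<close>. Writing
  the slope with \<open>c ^ k / c\<close> avoids the exponent \<open>k - 1\<close>.\<close>

lemma power_ge_tangent: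
  fixes y c :: real
  assumes "0 \<le> y" "0 < c"
  shows "c ^ k + real k * (c ^ k / c) * (y - c) \<le> y ^ k"
proof -
  have "1 + real k * (y / c - 1) \<le> (1 + (y / c - 1)) ^ k"
    using assms by (intro Bernoulli_inequality) simp
  then have "c ^ k * (1 + real k * (y / c - 1)) \<le> c ^ k * (y / c) ^ k"
    using assms by (intro mult_left_mono) auto
  also have "\<dots> = y ^ k"
    using assms by (simp add: power_divide)
  finally show ?thesis
    using assms by (simp add: field_simps)
qed

lemma polynomial_pos:
  fixes y :: real
  assumes y: "7 / 10 \<le> y" "y \<le> 1"
  shows "0 < 4 * (1 - y) * (1 + y) - 9 / 10 * (1 + 10 * y + y\<^sup>2)
    + y * (1 + y) * (4 + 4 / 25 * (\<Sum>i<5. y ^ i) + 4 / 81 * (\<Sum>i<9. y ^ i)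
        + 1 / 13 * (\<Sum>i<13. y ^ i) - 3 / 100)"
proof -
  \<comment> \<open>In the expanded polynomial the coefficient of \<open>y\<^sup>2\<close> is negative and all higher ones are positive:
    hence a chord for \<open>y\<^sup>2\<close> and tangents, taken near the minimum, for the higher powers.\<close>
  have chord: "y ^ 2 \<le> 17 / 10 * y - 7 / 10"
  proof -
    have "0 \<le> (y - 7 / 10) * (1 - y)"
      using y by simp
    also have "\<dots> = 17 / 10 * y - 7 / 10 - y ^ 2"
      by (simp add: field_simps power2_eq_square)
    finally show ?thesis
      by simp
  qed
  have tangent: "(77 / 100) ^ k + real k * ((77 / 100) ^ k / (77 / 100)) * (y - 77 / 100) \<le> y ^ k" for k
    using y by (intro power_ge_tangent) auto
  have shift: "y * (1 + y) * (\<Sum>i<n. y ^ i) = (\<Sum>i<n. y ^ (i + 1) + y ^ (i + 2))" for n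
    unfolding sum_distrib_left by (rule sum.cong) (auto simp: algebra_simps power2_eq_square)
  have distrib: "d * (4 + 4 / 25 * a + 4 / 81 * b + 1 / 13 * c - 3 / 100)
      = 397 / 100 * d + 4 / 25 * (d * a) + 4 / 81 * (d * b) + 1 / 13 * (d * c)" for a b c d :: real
    by (simp add: algebra_simps)
  have quadratics: "4 * (1 - y) * (1 + y) = 4 - 4 * y ^ 2" "y * (1 + y) = y + y ^ 2"
    by (simp_all add: algebra_simps power2_eq_square)
  have sums: "(\<Sum>i<5. y ^ (i + 1) + y ^ (i + 2)) = y + 2 * y ^ 2 + 2 * y ^ 3 + 2 * y ^ 4 + 2 * y ^ 5 + y ^ 6"
    "(\<Sum>i<9. y ^ (i + 1) + y ^ (i + 2)) = y + 2 * y ^ 2 + 2 * y ^ 3 + 2 * y ^ 4 + 2 * y ^ 5 + 2 * y ^ 6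
      + 2 * y ^ 7 + 2 * y ^ 8 + 2 * y ^ 9 + y ^ 10"
    "(\<Sum>i<13. y ^ (i + 1) + y ^ (i + 2)) = y + 2 * y ^ 2 + 2 * y ^ 3 + 2 * y ^ 4 + 2 * y ^ 5 + 2 * y ^ 6
      + 2 * y ^ 7 + 2 * y ^ 8 + 2 * y ^ 9 + 2 * y ^ 10 + 2 * y ^ 11 + 2 * y ^ 12 + 2 * y ^ 13 + y ^ 14"
    by (simp_all add: eval_nat_numeral)
  note tangents = tangent[of 3] tangent[of 4] tangent[of 5] tangent[of 6] tangent[of 7] tangent[of 8]
    tangent[of 9] tangent[of 10] tangent[of 11] tangent[of 12] tangent[of 13] tangent[of 14]
  have "0 < 4 - 4 * y ^ 2 - 9 / 10 * (1 + 10 * y + y ^ 2) + (397 / 100 * (y + y ^ 2)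
      + 4 / 25 * (\<Sum>i<5. y ^ (i + 1) + y ^ (i + 2)) + 4 / 81 * (\<Sum>i<9. y ^ (i + 1) + y ^ (i + 2))
      + 1 / 13 * (\<Sum>i<13. y ^ (i + 1) + y ^ (i + 2)))"
    \<comment> \<open>With every power of \<open>y\<close> taken as an atom, the goal is linear in
      them.\<close>
    unfolding sums using y chord tangents[unfolded power_divide, simplified] by argo
  then show ?thesis
    unfolding distrib shift unfolding quadratics .
qed

text \<open>This is \<open>polynomial_pos\<close> multiplied by
  \<open>(1 - y) / (y * (1 + y))\<close>; the 9/10 there is 27/5 divided by the 6 of
  \<open>minus_ln_le\<close>. The left-hand side is the margin reserved for the prime 2.\<close>

lemma smooth_part_lower:
  fixes y :: real
  assumes y: "7 / 10 \<le> y" "y < 1"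
  shows "3 / 100 * (1 - y) < 4 * (1 / y + y - 2) - 27 / 5 * (- ln y)
    + 1 / 4 * (16 * (1 - y) + 16 / 25 * (1 - y ^ 5) + 16 / 81 * (1 - y ^ 9) + 4 / 13 * (1 - y ^ 13))"
    (is "_ < ?R")
proof -
  let ?q = "4 + 4 / 25 * (\<Sum>i<5. y ^ i) + 4 / 81 * (\<Sum>i<9. y ^ i) + 1 / 13 * (\<Sum>i<13. y ^ i) - 3 / 100"
  have linear: "(1 - y) * (4 + 4 / 25 * a + 4 / 81 * b + 1 / 13 * c - 3 / 100)
      = 1 / 4 * (16 * (1 - y) + 16 / 25 * ((1 - y) * a) + 16 / 81 * ((1 - y) * b)
          + 4 / 13 * ((1 - y) * c)) - 3 / 100 * (1 - y)" for a b c
    by (simp add: field_simps)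
  let ?P = "4 * (1 - y) * (1 + y) - 9 / 10 * (1 + 10 * y + y\<^sup>2) + y * (1 + y) * ?q"
  have "0 < (1 - y) * ?P / (y * (1 + y))"
    using polynomial_pos[of y] y by simp
  also have "(1 - y) * ?P / (y * (1 + y)) = 4 * (1 / y + y - 2)
      - 27 / 5 * ((1 - y) * (1 + 10 * y + y\<^sup>2) / (6 * y * (1 + y))) + (1 - y) * ?q"
  proof -
    have "(1 - y) * ?P / (y * (1 + y))
        = (1 - y) * (4 * (1 - y) * (1 + y) - 9 / 10 * (1 + 10 * y + y\<^sup>2)) / (y * (1 + y)) + (1 - y) * ?q"
    proof -
      \<comment> \<open>Opaque \<open>A\<close>, \<open>d\<close> and \<open>q\<close> keep the long
        sums from being expanded.\<close>
      have "(1 - y) * (A + d * q) / d = (1 - y) * A / d + (1 - y) * q" if "d \<noteq> 0" for A d q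
        using that by (simp add: field_simps)
      then show ?thesis
        using y by simp
    qed
    also have "(1 - y) * (4 * (1 - y) * (1 + y) - 9 / 10 * (1 + 10 * y + y\<^sup>2)) / (y * (1 + y))
       = 4 * (1 / y + y - 2) - 27 / 5 * ((1 - y) * (1 + 10 * y + y\<^sup>2) / (6 * y * (1 + y)))"
      using y by (simp add: divide_simps) (simp add: algebra_simps power2_eq_square)
    finally show ?thesis .
  qed
  also have "\<dots> \<le> 4 * (1 / y + y - 2) - 27 / 5 * (- ln y) + (1 - y) * ?q"
    using minus_ln_le[of y] y by linarith
  also have "(1 - y) * ?q = 1 / 4 * (16 * (1 - y) + 16 / 25 * (1 - y ^ 5) + 16 / 81 * (1 - y ^ 9)
      + 4 / 13 * (1 - y ^ 13)) - 3 / 100 * (1 - y)"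
    unfolding one_diff_power_eq[of y 5] one_diff_power_eq[of y 9] one_diff_power_eq[of y 13]
    by (rule linear)
  finally show ?thesis
    by linarith
qed

section \<open>The von Mangoldt sum and the conclusion\<close>

text \<open>Below 3 only \<open>n = 2\<close> can contribute, and its weight
  \<open>ln 2 / sqrt 2\<close> is less than 1.\<close>

lemma mangoldt_sum_le:
  assumes "0 < t" "exp t < 3"
  shows "(\<Sum>n = 1..nat \<lfloor>exp t\<rfloor>. mangoldt n / sqrt (real n) * (t - ln (real n))) \<le> max 0 (t - ln 2)"
proof (cases "t < ln 2")
  case True
  then have "exp t < 2"
    by (metis exp_less_cancel_iff exp_ln zero_less_numeral)
  moreover have "1 < exp t"
    using assms by simp
  ultimately have "\<lfloor>exp t\<rfloor> = 1"
    by linarith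
  then show ?thesis
    by simp
next
  case False
  then have "2 \<le> exp t"
    by (metis exp_le_cancel_iff exp_ln not_less zero_less_numeral)
  with assms have "\<lfloor>exp t\<rfloor> = 2"
    by linarith
  then have "(\<Sum>n = 1..nat \<lfloor>exp t\<rfloor>. mangoldt n / sqrt (real n) * (t - ln (real n)))
      = ln 2 / sqrt 2 * (t - ln 2)"
    by (simp add: numeral_2_eq_2) (simp flip: numeral_2_eq_2)
  also have "\<dots> \<le> 1 * (t - ln 2)"
  proof (rule mult_right_mono)
    have "ln 2 \<le> (1 :: real)"
      using ln_2_less_1 by simp
    also have "1 \<le> sqrt 2"
      by simp
    finally show "ln 2 / sqrt 2 \<le> (1 :: real)"
      by simp
  qed (use False in simp)
  finally show ?thesis
    by simp
qed

theorem theorem4p1: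
  shows "\<exists>t0 > ln 2. \<forall>t. 0 < t \<and> t < t0 \<longrightarrow> Psi t > 0"
proof (intro exI conjI allI impI)
  \<comment> \<open>The excess 1/200 keeps \<open>y\<close> above 7/10, where the polynomial
    estimate is available, and stays below the margin.\<close>
  show "ln 2 < ln 2 + 1 / (200 :: real)"
    by simp
  fix t :: real
  assume t: "0 < t \<and> t < ln 2 + 1 / 200"
  define y where "y = exp (- t / 2)"
  let ?L = "deriv Gamma (1 / 4) / Gamma (1 / 4) - ln pi"
  let ?S = "C_const - exp (- t / 2) * Lerch_Phi (exp (- 2 * t)) 2 (1 / 4)"
  let ?M = "\<Sum>n = 1..nat \<lfloor>exp t\<rfloor>. mangoldt n / sqrt (real n) * (t - ln (real n))"
  have y_sq: "y\<^sup>2 = exp (- t)"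
    unfolding y_def by (simp flip: exp_of_nat_mult)
  have y1: "0 < y" "y < 1"
    using t by (auto simp: y_def)
  have half: "exp (- ln 2) = (1 / 2 :: real)"
    by (simp add: exp_minus)
  have y2: "49 / 100 < y\<^sup>2"
  proof -
    have "1 / 2 * (1 - 1 / 200) \<le> exp (- ln 2) * exp (- (1 / 200) :: real)"
      using exp_ge_add_one_self[of "- (1 / 200) :: real"] unfolding half by simp
    also have "\<dots> = exp (- (ln 2 + 1 / 200))"
      by (simp flip: exp_add)
    also have "\<dots> < y\<^sup>2"
      unfolding y_sq using t by simp
    finally show ?thesis
      by simp
  qed
  have S: "16 * (1 - y) + 16 / 25 * (1 - y ^ 5) + 16 / 81 * (1 - y ^ 9) + 4 / 13 * (1 - y ^ 13) \<le> ?S"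
    using t y1 sums_C_const_minus_Lerch_Phi[of t] unfolding y_def
    by (intro sum_power_quarter_lower) auto
  from y2 have y3: "7 / 10 \<le> y"
    using y1 power2_le_imp_le[of "7 / 10" y] by (simp add: power_divide)
  \<comment> \<open>This yields \<open>exp t < 100 / 49\<close>, hence
    \<open>exp t < 3\<close>.\<close>
  have "49 / 100 * exp t < y\<^sup>2 * exp t"
    using y2 by simp
  also have "\<dots> = 1"
    unfolding y_sq by (simp flip: exp_add)
  finally have "?M \<le> max 0 (t - ln 2)"
    using t by (intro mangoldt_sum_le) auto
  also have "\<dots> \<le> 3 / 100 * (1 - y)"
  proof (cases "t < ln 2")
    \<comment> \<open>Here \<open>y\<close> is at most 71/100, so the margin is at least 87/10000,
      which exceeds 1/200.\<close>
    case False
    then have "y\<^sup>2 \<le> 1 / 2"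
      unfolding y_sq half[symmetric] by simp
    also have "\<dots> \<le> (71 / 100)\<^sup>2"
      by (simp add: power_divide)
    finally have "y \<le> 71 / 100"
      by (rule power2_le_imp_le) simp
    then show ?thesis
      using t y1 by (simp add: max_def)
  qed (use y1 in auto)
  also have "\<dots> < 4 * (1 / y + y - 2) - 27 / 5 * (- ln y)
    + 1 / 4 * (16 * (1 - y) + 16 / 25 * (1 - y ^ 5) + 16 / 81 * (1 - y ^ 9) + 4 / 13 * (1 - y ^ 13))"
    by (rule smooth_part_lower[OF y3 y1(2)])
  also have "\<dots> \<le> 4 * (1 / y + y - 2) - 27 / 5 * (- ln y) + 1 / 4 * ?S"
    by (intro add_left_mono mult_left_mono S) simp
  also have "1 / y = exp (t / 2)"
    unfolding y_def by (simp add: exp_minus field_simps)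
  also have "- ln y = t / 2"
    unfolding y_def by simp
  also have "4 * (exp (t / 2) + y - 2) - 27 / 5 * (t / 2) + 1 / 4 * ?S
      \<le> 4 * (exp (t / 2) + y - 2) + t / 2 * ?L + 1 / 4 * ?S"
    using mult_left_mono[OF linear_coefficient_ge, of "t / 2"] t by simp
  finally show "0 < Psi t"
    unfolding Psi_def y_def by simp
qed

end
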